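(* Let $P_n(z)=\sum_{k=0}^n a_{k,n}z^k=a_n\prod_{k=1}^n(z-\alpha_{k,n})\in\mathbb{Z}_n^s(\mathbb{R}_+)$, $n\in\mathbb{N}$, be a sequence of polynomials (with $a_n=a_{n,n}$), and let $[c-2,c+2]\subset\mathbb{R}$, $c\ge 2$. If $\lim_{n\to\infty}(M(P_n))^{1/n}=1$, where $M(P_n)$ is the generalized Mahler measure associated with $[c-2,c+2]$, then $$\liminf_{n\to\infty}\frac{|a_{n-m,n}|}{\binom{n}{m}}\ge c^m\ge 2^m,\qquad m\in\mathbb{N}.$$
   Context: $\mathbb{R}_+:=(0,\infty)$ and $\mathbb{N}$ is the set of positive integers. $\mathbb{Z}_n^s(\mathbb{R}_+)$ denotes the set of polynomials with integer coefficients, of exact degree $n$, all of whose zeros are simple and lie in $\mathbb{R}_+$. For the interval $[c-2,c+2]$, let $\Omega:=\overline{\mathbb{C}}\setminus[c-2,c+2]$, where $\overline{\mathbb{C}}$ is the extended complex plane, let $D:=\{z\in\mathbb{C}:|z|\le1\}$, and let $\Phi$ be the canonical conformal mapping of $\Omega$ onto $\overline{\mathbb{C}}\setminus D$ with $\Phi(\infty)=\infty$. The generalized Mahler measure of $P_n(z)=a_n\prod_{k=1}^n(z-\alpha_{k,n})$ is $$M(P_n):=|a_n|\prod_{\alpha_{k,n}\in\Omega}|\Phi(\alpha_{k,n})|,$$ where an empty product equals $1$. In the conclusion $m$ is fixed while $n\to\infty$ (with $n\ge m$). *)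

theory Defs
  imports "HOL-Complex_Analysis.Complex_Analysis" "HOL-Computational_Algebra.Computational_Algebra"
begin

text \<open>
  The set of integer polynomials of exact degree \<open>n\<close> all of whose complex zeros are simple
  and lie in \<open>E\<close>.
\<close>
definition Z_simple :: "nat \<Rightarrow> complex set \<Rightarrow> int poly set" where
  "Z_simple n E =
     {p. p \<noteq> 0 \<and> degree p = n \<and>
         (\<forall>z. poly (map_poly of_int p) z = 0 \<longrightarrow> z \<in> E \<and> order z (map_poly of_int p) = 1)}"

definition pos_reals :: "complex set" where
  "pos_reals = complex_of_real ` {0<..}"

text \<open>The finite part of the complement of the interval in the extended plane.\<close>
definition ext_dom :: "real \<Rightarrow> complex set" where
  "ext_dom c = - (complex_of_real ` {c - 2..c + 2})"

text \<open>
  \<open>\<Phi>\<close> restricted to the finite plane.  A conformal bijection of the extended domains fixing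
  \<open>\<infinity>\<close> is the same thing as a holomorphic bijection of their finite parts that tends to
  \<open>\<infinity>\<close> at \<open>\<infinity>\<close>.  This determines \<open>\<Phi>\<close> up to a unimodular constant factor, so \<open>cmod (\<Phi> z)\<close>
  does not depend on the (unspecified) normalisation of the argument of \<open>\<Phi>'(\<infinity>)\<close>.
\<close>
definition exterior_map :: "real \<Rightarrow> (complex \<Rightarrow> complex) \<Rightarrow> bool" where
  "exterior_map c \<Phi> \<longleftrightarrow>
     \<Phi> holomorphic_on ext_dom c \<and>
     bij_betw \<Phi> (ext_dom c) (- cball 0 1) \<and>
     filterlim \<Phi> at_infinity at_infinity"

text \<open>The zeros are taken with multiplicity.\<close>
definition gen_mahler :: "real \<Rightarrow> (complex \<Rightarrow> complex) \<Rightarrow> complex poly \<Rightarrow> real" where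
  "gen_mahler c \<Phi> p =
     cmod (lead_coeff p) *
     (\<Prod>\<alpha>\<in>#filter_mset (\<lambda>\<alpha>. \<alpha> \<in> ext_dom c) (proots p). cmod (\<Phi> \<alpha>))"

text \<open>Such a map exists: the inverse of the shifted Joukowski map.\<close>

lemma joukowski_eq_iff:
  fixes w v c :: complex
  assumes "w \<noteq> 0" "v \<noteq> 0"
  shows "c + w + 1 / w = c + v + 1 / v \<longleftrightarrow> w = v \<or> w * v = 1"
proof -
  have "c + w + 1 / w = c + v + 1 / v \<longleftrightarrow> (w - v) * (w * v - 1) = 0"
    using assms by (auto simp: field_simps)
  then show ?thesis by simp
qed

lemma ex_exterior_map: "\<exists>\<Phi>. exterior_map c \<Phi>"
proof -
  define J :: "complex \<Rightarrow> complex" where "J = (\<lambda>w. of_real c + w + 1 / w)"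
  let ?E = "- cball (0::complex) 1"
  have nz: "w \<noteq> 0" if "w \<in> ?E" for w using that by auto
  have holJ: "J holomorphic_on ?E"
    unfolding J_def by (intro holomorphic_intros) (use nz in auto)
  have injJ: "inj_on J ?E"
  proof (rule inj_onI)
    fix w v assume wv: "w \<in> ?E" "v \<in> ?E" "J w = J v"
    have "cmod (w * v) > 1"
      using wv(1,2) by (simp add: norm_mult less_1_mult)
    then have "w * v \<noteq> 1" by auto
    then show "w = v" using wv joukowski_eq_iff[of w v] nz unfolding J_def by auto
  qed
  have unit: "\<exists>x\<in>{c - 2..c + 2}. J w = of_real x" if "cmod w = 1" for w
  proof -
    have "w * cnj w = 1" using that by (simp add: complex_norm_square[symmetric])
    then have "1 / w = cnj w" by (metis mult_eq_0_iff nonzero_mult_div_cancel_left zero_neq_one)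
    then have "J w = of_real (c + 2 * Re w)"
      unfolding J_def by (simp add: complex_eq_iff)
    moreover have "\<bar>Re w\<bar> \<le> 1" using abs_Re_le_cmod[of w] that by simp
    ultimately show ?thesis by (intro bexI[of _ "c + 2 * Re w"]) auto
  qed
  have preim: "\<exists>w. cmod w = 1 \<and> J w = of_real x" if "x \<in> {c - 2..c + 2}" for x
  proof -
    define t where "t = arccos ((x - c) / 2)"
    have "cos t = (x - c) / 2" unfolding t_def using that by (intro cos_arccos) auto
    moreover have "1 / cis t = cis (- t)" by (simp add: cis_inverse inverse_eq_divide[symmetric])
    ultimately show ?thesis
      by (intro exI[of _ "cis t"]) (auto simp: J_def complex_eq_iff)
  qed
  have imgJ: "J ` ?E = ext_dom c"
  proof (intro equalityI subsetI)
    fix z assume "z \<in> J ` ?E"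
    then obtain w where w: "w \<in> ?E" "z = J w" by auto
    show "z \<in> ext_dom c"
    proof (rule ccontr)
      assume "z \<notin> ext_dom c"
      then obtain x where "x \<in> {c - 2..c + 2}" "z = of_real x" by (auto simp: ext_dom_def)
      then obtain v where v: "cmod v = 1" "J v = J w" using preim w by metis
      have "v \<noteq> 0" using v by auto
      then have "v = w \<or> v * w = 1"
        using joukowski_eq_iff[of v w] v nz[OF w(1)] unfolding J_def by auto
      then have "cmod v * cmod w = 1 \<or> v = w" by (metis norm_mult norm_one)
      then show False using v w by auto
    qed
  next
    fix z assume z: "z \<in> ext_dom c"
    define b where "b = z - of_real c"
    define w where "w = (b + csqrt (b\<^sup>2 - 4)) / 2"
    have q: "w * w - b * w + 1 = 0"
    proof -
      have "w * w - b * w + 1 = ((csqrt (b\<^sup>2 - 4))\<^sup>2 - (b\<^sup>2 - 4)) / 4"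
        unfolding w_def by (simp add: power2_eq_square add_divide_distrib diff_divide_distrib algebra_simps)
      then show ?thesis by simp
    qed
    have w0: "w \<noteq> 0" using q by auto
    have Jw: "J w = z" using q w0 unfolding J_def b_def by (simp add: field_simps)
    have Jinv: "J (1 / w) = J w" using w0 unfolding J_def by simp
    have "cmod w \<noteq> 1"
    proof
      assume "cmod w = 1"
      from unit[OF this] Jw z show False by (auto simp: ext_dom_def)
    qed
    then consider "cmod w > 1" | "cmod w < 1" by linarith
    then show "z \<in> J ` ?E"
    proof cases
      case 1
      then show ?thesis using Jw by (intro image_eqI[of _ _ w]) auto
    next
      case 2
      then have "cmod (1 / w) > 1" using w0 by (simp add: norm_divide field_simps)
      then show ?thesis using Jw Jinv by (intro image_eqI[of _ _ "1 / w"]) auto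
    qed
  qed
  obtain \<Phi> where hol: "\<Phi> holomorphic_on (J ` ?E)" and inv: "\<And>w. w \<in> ?E \<Longrightarrow> \<Phi> (J w) = w"
    using holomorphic_has_inverse[OF holJ _ injJ] by (metis closed_cball open_Compl)
  have bij: "bij_betw \<Phi> (ext_dom c) ?E"
  proof (rule bij_betwI[where g = J])
    show "\<Phi> \<in> ext_dom c \<rightarrow> ?E" using inv imgJ by (auto simp: image_iff) force
    show "J \<in> ?E \<rightarrow> ext_dom c" using imgJ by auto
  qed (use inv imgJ[symmetric] in auto)
  have "filterlim (\<lambda>z. cmod (\<Phi> z)) at_top at_infinity"
  proof (rule filterlim_at_top_mono)
    have "filterlim (\<lambda>z. cmod z - \<bar>c\<bar> - 1) at_top at_infinity"
      using filterlim_tendsto_add_at_top[OF tendsto_const[of "- \<bar>c\<bar> - 1"] filterlim_norm_at_top]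
      by (simp add: algebra_simps)
    then show "filterlim (\<lambda>z::complex. cmod z - \<bar>c\<bar> - 1) at_top at_infinity" .
    have "cmod z - \<bar>c\<bar> - 1 \<le> cmod (\<Phi> z)" if "cmod z \<ge> \<bar>c\<bar> + 3" for z
    proof -
      have "z \<in> ext_dom c" using that by (auto simp: ext_dom_def)
      then obtain w where w: "w \<in> ?E" "z = J w" using imgJ by blast
      have "cmod z \<le> \<bar>c\<bar> + cmod w + cmod (1 / w)"
        unfolding w(2) J_def by (intro norm_triangle_le add_mono) auto
      moreover have "cmod (1 / w) \<le> 1" using w(1) by (simp add: norm_divide divide_le_eq)
      ultimately show ?thesis using inv[OF w(1)] w(2) by simp
    qed
    then show "\<forall>\<^sub>F z in at_infinity. cmod z - \<bar>c\<bar> - 1 \<le> cmod (\<Phi> z)"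
      unfolding eventually_at_infinity by blast
  qed
  then have "filterlim \<Phi> at_infinity at_infinity" by (rule filterlim_norm_at_top_imp_at_infinity)
  then show ?thesis using hol bij imgJ unfolding exterior_map_def by auto
qed

end

theory Submission
  imports Defs "Jordan_Normal_Form.Determinant" "HOL-Real_Asymp.Real_Asymp"
begin

text \<open>
  Every zero is written as \<open>\<alpha> = c + u + 1/u\<close> with \<open>0 < \<bar>u\<bar> \<le> 1\<close>. For \<open>\<alpha>\<close> in the interval
  \<open>[c - 2, c + 2]\<close> the parameter \<open>u\<close> lies on the unit circle and \<open>\<alpha> = c + 2 Re u\<close>; elsewhere
  \<open>\<bar>u\<bar> < 1\<close>, and \<open>1/\<bar>u\<bar> \<le> \<bar>\<Phi>(\<alpha>)\<bar>\<close> by the Schwarz lemma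
  (\<open>inverse_norm_le_norm_exterior_map\<close>). Hence \<open>ln \<bar>a\<bar> + \<Sum> ln (1/\<bar>u\<bar>) \<le> ln M\<close>, where \<open>a\<close> is the
  leading coefficient, and \<open>ln M = o(n)\<close> by hypothesis.

  The point is that also \<open>\<Sum> Re u = o(n)\<close>, which is equidistribution of the zeros with respect to the
  arcsine law at the level of the first moment. Since the zeros are simple, the discriminant is a
  nonzero integer, so that \<open>\<Sum> ln \<bar>\<alpha> - \<beta>\<bar>\<close>, taken over pairs of different zeros, is not too negative
  (\<open>ln_discriminant_nonneg\<close>). On the other hand, in terms of the parameters \<open>s, t\<close> of \<open>\<alpha>, \<beta>\<close>,
    \<open>ln \<bar>\<alpha> - \<beta>\<bar> \<le> ln (1/\<bar>s\<bar>) + ln (1/\<bar>t\<bar>) + ln \<bar>1 - cnj s t\<bar> + ln \<bar>1 - s t\<bar>\<close>,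
  and the last two terms have the expansion \<open>- \<Sum>k. (2/k) Re (s^k) Re (t^k)\<close>, a negative
  semidefinite kernel. Damping it by a factor \<open>r^k\<close> with \<open>r < 1\<close>, which costs little, makes its diagonal finite, and
  keeping only \<open>k = 1\<close> in the sum over all pairs bounds \<open>(\<Sum> Re u)^2\<close> by \<open>o(n^2)\<close> when \<open>r = 1 - 1/n\<close>
  (\<open>sum_ln_joukowski_diff_le\<close>).

  For a positive zero \<open>min \<alpha> (c + 2) \<ge> c + 2 Re u - 2 c ln (1/\<bar>u\<bar>)\<close>, so the truncated zeros have mean
  at least \<open>c - o(1)\<close> (\<open>sum_truncated_zeros_ge\<close>). Finally \<open>\<bar>a_{n-m}\<bar>\<close> is \<open>\<bar>a\<bar> \<ge> 1\<close> times the \<open>m\<close>-th elementary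
  symmetric function of the zeros, which is increasing in each of the positive zeros; for numbers in
  the bounded range \<open>[0, c + 2]\<close> it equals the \<open>m\<close>-th power of the mean times \<open>n choose m\<close> up to lower
  order terms (\<open>coeff_prod_linear_ge\<close>).
\<close>

section \<open>Integrality of the resultant\<close>

text \<open>
  A vector in the kernel of the transposed matrix is the coefficient vector of a polynomial of degree
  less than \<open>n\<close> with \<open>n\<close> zeros.
\<close>
lemma det_vandermonde_nonzero:
  fixes x :: "nat \<Rightarrow> 'a :: field"
  assumes "inj_on x {0..<n}"
  shows "det (mat n n (\<lambda>(i, j). x j ^ i)) \<noteq> 0"
proof
  let ?V = "mat n n (\<lambda>(i, j). x j ^ i)"
  assume "det ?V = 0"
  then have "det (transpose_mat ?V) = 0" by (subst det_transpose[of _ n]) auto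
  then obtain v where v: "v \<in> carrier_vec n" "v \<noteq> 0\<^sub>v n" "transpose_mat ?V *\<^sub>v v = 0\<^sub>v n"
    using det_0_iff_vec_prod_zero_field[of "transpose_mat ?V" n] by auto
  define f where "f = (\<Sum>i<n. monom (vec_index v i) i)"
  have coeff_f: "coeff f i = (if i < n then vec_index v i else 0)" for i
    by (simp add: f_def coeff_sum if_distrib cong: if_cong)
  obtain i where "i < n" "vec_index v i \<noteq> 0"
    using v(1,2) by (metis carrier_vecD eq_vecI index_zero_vec(1,2))
  then have f0: "f \<noteq> 0" using coeff_f[of i] by auto
  have deg: "degree f < n"
    using f0 coeff_f by (metis leading_coeff_0_iff)
  have "poly f (x j) = 0" if j: "j < n" for j
  proof -
    have "poly f (x j) = (\<Sum>i<n. vec_index v i * x j ^ i)"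
      by (simp add: f_def poly_sum poly_monom)
    also have "\<dots> = vec_index (transpose_mat ?V *\<^sub>v v) j"
      using j v(1) by (auto simp: scalar_prod_def lessThan_atLeast0 mult.commute intro!: sum.cong)
    finally show ?thesis using v(3) j by simp
  qed
  then have "x ` {0..<n} \<subseteq> {z. poly f z = 0}" by auto
  then have "n \<le> card {z. poly f z = 0}"
    using card_mono[OF poly_roots_finite[OF f0], of "x ` {0..<n}"] card_image[OF assms] by simp
  with card_poly_roots_bound[OF f0] deg show False by linarith
qed

lemma poly_eq_sum_below:
  fixes p :: "'a :: comm_semiring_1 poly"
  assumes "p = 0 \<or> degree p < n"
  shows "poly p x = (\<Sum>k<n. coeff p k * x ^ k)"
proof (cases "p = 0")
  case False
  with assms have "{..degree p} \<subseteq> {..<n}" by auto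
  then show ?thesis unfolding poly_altdef
    by (intro sum.mono_neutral_left) (auto simp: coeff_eq_0)
qed auto

text \<open>
  Up to sign the number is the resultant of \<open>p\<close> and \<open>q\<close>, with \<open>q\<close> regarded as a polynomial of degree
  \<open>d\<close>, that is, the determinant of the integer matrix \<open>S\<close> whose rows are the coefficients of
  \<open>X^i q\<close> (\<open>i < n\<close>) and \<open>X^i p\<close> (\<open>i < d\<close>). To evaluate it over the complex numbers, apply to these
  rows the \<open>n\<close> evaluations at the zeros of \<open>p\<close> and the \<open>d\<close> top coefficients. This multiplies \<open>S\<close> by a
  matrix \<open>W\<close> with nonzero (Vandermonde) determinant, and makes the product block triangular because
  \<open>p\<close> vanishes at its zeros.
\<close>
lemma lead_coeff_power_times_prod_over_roots_Ints:
  fixes p q :: "int poly"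
  assumes Z: "card {z::complex. poly (map_poly of_int p) z = 0} = degree p" and p: "p \<noteq> 0"
    and q: "degree q \<le> d"
  shows "of_int (lead_coeff p) ^ d * (\<Prod>z | poly (map_poly of_int p) z = 0. poly (map_poly of_int q) z)
    \<in> (\<int> :: complex set)"
proof -
  define n where "n = degree p"
  define pc qc :: "complex poly" where "pc = map_poly of_int p" and "qc = map_poly of_int q"
  have deg: "degree pc = n" "degree qc \<le> d" using q by (simp_all add: pc_def qc_def n_def degree_map_poly)
  have lc: "coeff pc n = of_int (lead_coeff p)" by (simp add: pc_def n_def coeff_map_poly)
  have pc0: "pc \<noteq> 0" using p by (simp add: pc_def map_poly_eq_0_iff)
  have fin: "finite {z. poly pc z = 0}" using poly_roots_finite[OF pc0] .
  obtain x where x: "bij_betw x {0..<n} {z. poly pc z = 0}"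
    using ex_bij_betw_nat_finite[OF fin] Z unfolding n_def pc_def by auto
  define f :: "nat \<Rightarrow> int poly" where
    "f i = (if i < n then monom 1 i * q else monom 1 (i - n) * p)" for i
  define fc :: "nat \<Rightarrow> complex poly" where
    "fc i = (if i < n then monom 1 i * qc else monom 1 (i - n) * pc)" for i
  have f_fc: "of_int (coeff (f i) k) = coeff (fc i) k" for i k
    by (simp add: f_def fc_def pc_def qc_def coeff_monom_mult coeff_map_poly)
  have deg_fc: "degree (fc i) < n + d" if "i < n + d" for i
  proof -
    have "degree (fc i) \<le> (if i < n then i + d else i - n + n)"
      unfolding fc_def using deg
      by (auto intro!: order.trans[OF degree_mult_le] simp: degree_monom_eq)
    then show ?thesis using that by (auto split: if_splits)
  qed
  let ?N = "n + d"
  \<comment> \<open>The block \<open>V * D\<close> holds the values of \<open>X^i q\<close> at the zeros, \<open>T\<close> the top coefficients of \<open>X^i p\<close>.\<close>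
  define S where "S = mat ?N ?N (\<lambda>(i, k). coeff (f i) k)"
  define W where "W = mat ?N ?N (\<lambda>(k, j). if j < n then x j ^ k else if k = j then 1 else 0)"
  define V where "V = mat n n (\<lambda>(i, j). x j ^ i)"
  define D where "D = mat n n (\<lambda>(i, j). if i = j then poly qc (x j) else 0)"
  define T where "T = mat d d (\<lambda>(i, l). coeff (monom 1 i * pc) (n + l))"
  have carr: "S \<in> carrier_mat ?N ?N" "W \<in> carrier_mat ?N ?N" "V \<in> carrier_mat n n"
    "D \<in> carrier_mat n n" "T \<in> carrier_mat d d"
    by (simp_all add: S_def W_def V_def D_def T_def)
  have VD: "V * D = mat n n (\<lambda>(i, j). x j ^ i * poly qc (x j))"
    by (intro eq_matI) (auto simp: V_def D_def scalar_prod_def mult_delta_right)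
  have W_block: "W = four_block_mat V (0\<^sub>m n d) (mat d n (\<lambda>(k, j). x j ^ (k + n))) (1\<^sub>m d)"
    by (intro eq_matI) (auto simp: W_def V_def)
  have "map_mat of_int S * W =
      four_block_mat (V * D) (mat n d (\<lambda>(i, l). coeff (fc i) (n + l))) (0\<^sub>m d n) T" (is "?L = ?R")
  proof (intro eq_matI)
    fix i j assume "i < dim_row ?R" "j < dim_col ?R"
    then have ij: "i < ?N" "j < ?N" by (auto simp: VD T_def)
    have "?L $$ (i, j) = (\<Sum>k<?N. coeff (fc i) k * (if j < n then x j ^ k else if k = j then 1 else 0))"
      using ij by (simp add: S_def W_def scalar_prod_def f_fc lessThan_atLeast0 cong: sum.cong_simp)
    also have "\<dots> = (if j < n then poly (fc i) (x j) else coeff (fc i) j)"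
    proof (cases "j < n")
      case True
      then show ?thesis using deg_fc[OF ij(1)] by (simp add: poly_eq_sum_below[of _ ?N])
    next
      case False
      then have "(\<Sum>k<?N. coeff (fc i) k * (if j < n then x j ^ k else if k = j then 1 else 0))
          = (\<Sum>k<?N. if k = j then coeff (fc i) k else 0)"
        by (intro sum.cong) auto
      then show ?thesis using False ij(2) by simp
    qed
    also have "\<dots> = ?R $$ (i, j)"
    proof -
      have "poly pc (x j) = 0" if "j < n" using x that by (auto simp: bij_betw_def)
      then show ?thesis using ij
        by (auto simp: VD T_def fc_def poly_monom)
    qed
    finally show "?L $$ (i, j) = ?R $$ (i, j)" .
  qed (auto simp: S_def W_def V_def D_def T_def)
  then have "det (map_mat of_int S) * det W = det (V * D) * det T"
    using det_mult[of "map_mat of_int S" ?N W] carr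
      det_four_block_mat_lower_left_zero[OF _ _ refl, of "V * D" n _ d T]
    by auto
  moreover have "det W = det V"
    unfolding W_block by (subst det_four_block_mat_upper_right_zero[of _ n _ d]) (auto simp: V_def)
  moreover have "det (V * D) = det V * (\<Prod>j=0..<n. poly qc (x j))"
  proof -
    have "det D = (\<Prod>j=0..<n. poly qc (x j))"
      by (subst det_upper_triangular[of _ n])
        (auto simp: D_def diag_mat_def prod.distinct_set_conv_list[symmetric] cong: map_cong)
    then show ?thesis by (subst det_mult[of _ n]) (auto simp: V_def D_def)
  qed
  moreover have "det T = of_int (lead_coeff p) ^ d"
  proof -
    have "det T = prod_list (diag_mat T)"
      using deg(1) by (intro det_lower_triangular[of d]) (auto simp: T_def coeff_monom_mult coeff_eq_0)
    also have "diag_mat T = replicate d (coeff pc n)"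
      by (intro nth_equalityI) (auto simp: diag_mat_def T_def coeff_monom_mult)
    finally show ?thesis by (simp add: lc)
  qed
  moreover have "det V \<noteq> 0"
    unfolding V_def using x by (intro det_vandermonde_nonzero) (auto simp: bij_betw_def)
  ultimately have "of_int (lead_coeff p) ^ d * (\<Prod>j=0..<n. poly qc (x j)) = of_int (det S)"
    by (simp add: of_int_hom.hom_det)
  moreover have "(\<Prod>j=0..<n. poly qc (x j)) = (\<Prod>z | poly pc z = 0. poly qc z)"
    using prod.reindex_bij_betw[OF x] .
  ultimately show ?thesis by (metis Ints_of_int pc_def qc_def)
qed

section \<open>The logarithmic energy in Joukowski coordinates\<close>

text \<open>
  The difference of the squares is \<open>(1 - \<bar>s\<bar>^2) (1 - \<bar>t\<bar>^2)\<close>, the identity behind the Blaschke factors.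
\<close>
lemma norm_diff_le_norm_one_minus_cnj_mult:
  assumes "cmod s \<le> 1" "cmod t \<le> 1"
  shows "cmod (s - t) \<le> cmod (1 - cnj s * t)"
proof -
  have "(cmod (1 - cnj s * t))\<^sup>2 - (cmod (s - t))\<^sup>2 = (1 - (cmod s)\<^sup>2) * (1 - (cmod t)\<^sup>2)"
    by (simp add: cmod_power2) (simp add: power2_eq_square algebra_simps)
  also have "\<dots> \<ge> 0" using assms by (intro mult_nonneg_nonneg) (simp_all add: abs_square_le_1)
  finally show ?thesis by - (rule power2_le_imp_le, simp_all)
qed

text \<open>
  On the closed unit disc the modulus of \<open>(1 - z) / (1 - r z)\<close> is largest at \<open>z = -1\<close>.
\<close>
lemma norm_one_minus_le_norm_one_minus_scaled:
  assumes z: "cmod z \<le> 1" and r: "0 < r" "r < 1"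
  shows "cmod (1 - z) \<le> 2 / (1 + r) * cmod (1 - of_real r * z)"
proof -
  define a where "a = Re z"
  define q where "q = (cmod z)\<^sup>2"
  have q1: "q \<le> 1" using z by (simp add: q_def abs_square_le_1)
  have a1: "a \<ge> -1" using abs_Re_le_cmod[of z] z by (simp add: a_def)
  have 1: "(cmod (1 - z))\<^sup>2 = 1 - 2 * a + q"
    by (simp add: cmod_power2 a_def q_def) (simp add: power2_eq_square algebra_simps)
  have 2: "(cmod (1 - of_real r * z))\<^sup>2 = 1 - 2 * r * a + r\<^sup>2 * q"
    by (simp add: cmod_power2 a_def q_def) (simp add: power2_eq_square algebra_simps)
  have "(2 * cmod (1 - of_real r * z))\<^sup>2 - ((1 + r) * cmod (1 - z))\<^sup>2
      = (1 - r) * ((3 + r) + 2 * (1 - r) * a - (1 + 3 * r) * q)"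
    unfolding power_mult_distrib 1 2 by (simp add: power2_eq_square algebra_simps)
  also have "\<dots> \<ge> 0"
  proof (intro mult_nonneg_nonneg)
    have "2 * (1 - r) * a \<ge> 2 * (1 - r) * (-1)" using r a1 by (intro mult_left_mono) auto
    moreover have "(1 + 3 * r) * q \<le> (1 + 3 * r) * 1" using r q1 by (intro mult_left_mono) auto
    ultimately show "0 \<le> (3 + r) + 2 * (1 - r) * a - (1 + 3 * r) * q" by (simp add: algebra_simps)
  qed (use r in auto)
  finally have "(1 + r) * cmod (1 - z) \<le> 2 * cmod (1 - of_real r * z)"
    by - (rule power2_le_imp_le, simp_all)
  then show ?thesis using r by (simp add: field_simps)
qed

lemma sums_minus_ln_norm_one_minus:
  assumes "cmod z < 1"
  shows "(\<lambda>k. Re (z ^ k) / real k) sums (- ln (cmod (1 - z)))"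
proof -
  have "(\<lambda>k. - (z ^ k) / of_nat k) sums ln (1 - z)"
    using Ln_series'[of "- z"] assms by simp
  then have "(\<lambda>k. Re (- (z ^ k) / of_nat k)) sums Re (ln (1 - z))" by (rule sums_Re)
  moreover have "1 - z \<noteq> 0" using assms by auto
  ultimately have "(\<lambda>k. - (Re (- (z ^ k) / of_nat k))) sums (- ln (cmod (1 - z)))"
    by (intro sums_minus) simp
  then show ?thesis by simp
qed

lemma norm_scaled_mult_le:
  assumes "cmod a \<le> 1" "cmod b \<le> 1" "0 \<le> r"
  shows "cmod (of_real r * (a * b)) \<le> r"
  using assms by (simp add: norm_mult mult_left_le mult_le_one)

text \<open>
  The kernel \<open>- ln \<bar>1 - r (cnj s) t\<bar> - ln \<bar>1 - r s t\<bar>\<close> expands as \<open>\<Sum>k. (2 r^k/k) Re (s^k) Re (t^k)\<close>.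
  Its double sum is therefore a series of multiples of squares, of which only the term \<open>k = 1\<close> is kept.
\<close>
lemma energy_ge_first_moment_squared:
  fixes u :: "'a \<Rightarrow> complex"
  assumes I: "finite I" and u: "\<And>i. i \<in> I \<Longrightarrow> cmod (u i) \<le> 1" and r: "0 < r" "r < 1"
  shows "2 * r * (\<Sum>i\<in>I. Re (u i))\<^sup>2 \<le>
    (\<Sum>i\<in>I. \<Sum>j\<in>I. - ln (cmod (1 - of_real r * (cnj (u i) * u j)))
      - ln (cmod (1 - of_real r * (u i * u j))))"
    (is "_ \<le> ?E")
proof -
  have small: "cmod (of_real r * (a * b)) < 1" if "cmod a \<le> 1" "cmod b \<le> 1" for a b
    using norm_scaled_mult_le[OF that, of r] r by simp
  have "(\<lambda>k. \<Sum>i\<in>I. \<Sum>j\<in>I. Re ((of_real r * (cnj (u i) * u j)) ^ k) / real k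
      + Re ((of_real r * (u i * u j)) ^ k) / real k) sums
    (\<Sum>i\<in>I. \<Sum>j\<in>I. - ln (cmod (1 - of_real r * (cnj (u i) * u j)))
      + - ln (cmod (1 - of_real r * (u i * u j))))"
    using u by (intro sums_sum sums_add sums_minus_ln_norm_one_minus small) auto
  moreover have "(\<Sum>i\<in>I. \<Sum>j\<in>I. Re ((of_real r * (cnj (u i) * u j)) ^ k) / real k
      + Re ((of_real r * (u i * u j)) ^ k) / real k)
    = 2 * r ^ k / real k * (\<Sum>i\<in>I. Re (u i ^ k))\<^sup>2" for k
  proof -
    have "Re ((of_real r * (cnj a * b)) ^ k) / real k + Re ((of_real r * (a * b)) ^ k) / real k
        = 2 * r ^ k / real k * (Re (a ^ k) * Re (b ^ k))" for a b
    proof -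
      have "(of_real r * (cnj a * b)) ^ k + (of_real r * (a * b)) ^ k
          = of_real (r ^ k) * ((cnj (a ^ k) + a ^ k) * b ^ k)"
        by (simp add: power_mult_distrib algebra_simps)
      also have "cnj (a ^ k) + a ^ k = of_real (2 * Re (a ^ k))"
        by (metis add.commute complex_add_cnj)
      finally have "Re ((of_real r * (cnj a * b)) ^ k) + Re ((of_real r * (a * b)) ^ k)
          = 2 * r ^ k * (Re (a ^ k) * Re (b ^ k))"
        by (metis Re_complex_of_real plus_complex.sel(1) times_complex.sel(1) Im_complex_of_real
            mult_zero_left diff_zero mult.assoc mult.left_commute)
      then show ?thesis by (simp add: add_divide_distrib[symmetric])
    qed
    then have "(\<Sum>i\<in>I. \<Sum>j\<in>I. Re ((of_real r * (cnj (u i) * u j)) ^ k) / real k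
      + Re ((of_real r * (u i * u j)) ^ k) / real k)
      = (\<Sum>i\<in>I. \<Sum>j\<in>I. 2 * r ^ k / real k * (Re (u i ^ k) * Re (u j ^ k)))"
      by (simp only:)
    also have "\<dots> = 2 * r ^ k / real k * (\<Sum>i\<in>I. \<Sum>j\<in>I. Re (u i ^ k) * Re (u j ^ k))"
      by (simp only: sum_distrib_left)
    finally show ?thesis by (simp only: power2_eq_square sum_product)
  qed
  ultimately have sums: "(\<lambda>k. 2 * r ^ k / real k * (\<Sum>i\<in>I. Re (u i ^ k))\<^sup>2) sums ?E"
    by simp
  have "sum (\<lambda>k. 2 * r ^ k / real k * (\<Sum>i\<in>I. Re (u i ^ k))\<^sup>2) {1} \<le> ?E"
    using sum_le_suminf[OF sums_summable[OF sums], of "{1}"] sums_unique[OF sums] r by auto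
  then show ?thesis by simp
qed

lemma joukowski_diff:
  fixes s t :: complex
  assumes "s \<noteq> 0" "t \<noteq> 0"
  shows "(s + 1 / s) - (t + 1 / t) = - ((s - t) * (1 - s * t)) / (s * t)"
  using assms by (simp add: field_simps)

text \<open>
  An upper bound for the logarithmic energy of the points \<open>u + 1/u\<close>. The factors \<open>1 - (cnj s) t\<close> and
  \<open>1 - s t\<close> are replaced by \<open>1 - r (cnj s) t\<close> and \<open>1 - r s t\<close> at the price of \<open>ln (2 / (1 + r))\<close> per
  factor; then the diagonal terms, each at most \<open>2 ln (1 / (1 - r))\<close>, can be added to complete the
  quadratic form.
\<close>
lemma sum_ln_joukowski_diff_le:
  fixes u :: "'a \<Rightarrow> complex"
  assumes I: "finite I" and u: "\<And>i. i \<in> I \<Longrightarrow> u i \<noteq> 0 \<and> cmod (u i) \<le> 1"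
    and inj: "inj_on (\<lambda>i. u i + 1 / u i) I" and r: "0 < r" "r < 1"
  shows "(\<Sum>i\<in>I. \<Sum>j\<in>I - {i}. ln (cmod ((u i + 1 / u i) - (u j + 1 / u j))))
    \<le> 2 * (real (card I) - 1) * (\<Sum>i\<in>I. - ln (cmod (u i)))
      - 2 * r * (\<Sum>i\<in>I. Re (u i))\<^sup>2 + 2 * real (card I) * ln (1 / (1 - r))
      + 2 * real (card I) * (real (card I) - 1) * ln (2 / (1 + r))"
proof -
  define h where "h i = - ln (cmod (u i))" for i
  define K where "K i j = - ln (cmod (1 - of_real r * (cnj (u i) * u j)))
      - ln (cmod (1 - of_real r * (u i * u j)))" for i j
  define n where "n = real (card I)"
  let ?L = "ln (2 / (1 + r))"
  have lower: "1 - r \<le> cmod (1 - of_real r * (a * b))" if "cmod a \<le> 1" "cmod b \<le> 1" for a b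
    using norm_scaled_mult_le[OF that, of r] norm_triangle_ineq2[of 1 "of_real r * (a * b)"] r
    by (simp del: norm_mult)
  have ln_split: "ln (((w * a) * (w * b)) / (p * q)) = (ln w + ln a) + (ln w + ln b) - (ln p + ln q)"
    if "w > 0" "a > 0" "b > 0" "p > 0" "q > 0" for w a b p q :: real
    using that by (simp add: ln_mult ln_div)
  have pair: "ln (cmod ((u i + 1 / u i) - (u j + 1 / u j))) \<le> h i + h j - K i j + 2 * ?L"
    if ij: "i \<in> I" "j \<in> I" "i \<noteq> j" for i j
  proof -
    let ?s = "u i" and ?t = "u j"
    let ?A = "cmod (1 - of_real r * (cnj ?s * ?t))" and ?B = "cmod (1 - of_real r * (?s * ?t))"
    have st: "?s \<noteq> 0" "?t \<noteq> 0" "cmod ?s \<le> 1" "cmod ?t \<le> 1" using u ij by auto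
    have "(u i + 1 / u i) - (u j + 1 / u j) \<noteq> 0" using inj ij by (auto dest: inj_onD)
    then have pos: "cmod ((u i + 1 / u i) - (u j + 1 / u j)) > 0" by simp
    have AB: "?A > 0" "?B > 0"
      using lower[of "cnj ?s" ?t] lower[of ?s ?t] st r by auto
    have st1: "cmod (?s * ?t) \<le> 1" "cmod (cnj ?s * ?t) \<le> 1"
      using st by (simp_all add: norm_mult mult_le_one)
    have "cmod (?s - ?t) \<le> 2 / (1 + r) * ?A"
      using norm_diff_le_norm_one_minus_cnj_mult[of ?s ?t] st
        norm_one_minus_le_norm_one_minus_scaled[OF st1(2) r] by linarith
    moreover have "cmod (1 - ?s * ?t) \<le> 2 / (1 + r) * ?B"
      using norm_one_minus_le_norm_one_minus_scaled[OF st1(1) r] .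
    ultimately have "cmod (?s - ?t) * cmod (1 - ?s * ?t) \<le> (2 / (1 + r) * ?A) * (2 / (1 + r) * ?B)"
      by (rule mult_mono) (use r in auto)
    then have "cmod ((u i + 1 / u i) - (u j + 1 / u j))
        \<le> ((2 / (1 + r) * ?A) * (2 / (1 + r) * ?B)) / (cmod ?s * cmod ?t)"
      unfolding joukowski_diff[OF st(1,2)] using st
      by (simp only: norm_divide norm_minus_cancel norm_mult divide_right_mono mult_nonneg_nonneg norm_ge_zero)
    then have "ln (cmod ((u i + 1 / u i) - (u j + 1 / u j)))
        \<le> ln (((2 / (1 + r) * ?A) * (2 / (1 + r) * ?B)) / (cmod ?s * cmod ?t))"
      using pos by (simp add: ln_mono)
    also have "\<dots> = (?L + ln ?A) + (?L + ln ?B) - (ln (cmod ?s) + ln (cmod ?t))"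
    proof (rule ln_split)
      show "2 / (1 + r) > 0" "cmod ?s > 0" "cmod ?t > 0" using r st by auto
    qed (use AB in auto)
    finally show ?thesis by (simp add: h_def K_def)
  qed
  have card_less: "real (card I - Suc 0) = n - 1" if "i \<in> I" for i
    using that I card_gt_0_iff[of I] by (auto simp: n_def of_nat_diff Suc_le_eq)
  have diag: "K i i \<le> 2 * ln (1 / (1 - r))" if "i \<in> I" for i
  proof -
    have "ln (1 - r) \<le> ln (cmod (1 - of_real r * (cnj (u i) * u i)))"
      "ln (1 - r) \<le> ln (cmod (1 - of_real r * (u i * u i)))"
      using lower[of "cnj (u i)" "u i"] lower[of "u i" "u i"] u[OF that] r
      by (auto intro!: ln_mono)
    then show ?thesis using r by (simp add: K_def ln_div)
  qed
  have "(\<Sum>i\<in>I. \<Sum>j\<in>I - {i}. ln (cmod ((u i + 1 / u i) - (u j + 1 / u j))))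
      \<le> (\<Sum>i\<in>I. \<Sum>j\<in>I - {i}. h i + h j - K i j + 2 * ?L)"
    using pair by (intro sum_mono) auto
  also have "\<dots> = (\<Sum>i\<in>I. (n - 2) * h i + (\<Sum>j\<in>I. h j) - (\<Sum>j\<in>I. K i j) + K i i + (n - 1) * (2 * ?L))"
    using I
    by (intro sum.cong refl, simp add: sum.distrib sum_subtractf sum_diff1 card_less)
      (simp add: algebra_simps)
  also have "\<dots> = 2 * (n - 1) * (\<Sum>i\<in>I. h i) - (\<Sum>i\<in>I. \<Sum>j\<in>I. K i j) + (\<Sum>i\<in>I. K i i) + n * (n - 1) * (2 * ?L)"
    by (simp add: sum.distrib sum_subtractf sum_distrib_left[symmetric] n_def)
      (simp add: algebra_simps)
  also have "\<dots> \<le> 2 * (n - 1) * (\<Sum>i\<in>I. h i) - 2 * r * (\<Sum>i\<in>I. Re (u i))\<^sup>2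
      + n * (2 * ln (1 / (1 - r))) + n * (n - 1) * (2 * ?L)"
    using energy_ge_first_moment_squared[OF I _ r, of u] u sum_bounded_above[of I "\<lambda>i. K i i", OF diag]
    by (simp add: K_def n_def)
  finally show ?thesis by (simp add: h_def n_def algebra_simps)
qed

section \<open>Elementary symmetric functions of bounded variables\<close>

lemma coeff_prod_linear_nonneg:
  fixes y :: "'a \<Rightarrow> real"
  assumes "\<And>i. i \<in> I \<Longrightarrow> 0 \<le> y i"
  shows "0 \<le> coeff (\<Prod>i\<in>I. [:1, y i:]) m"
  using assms
proof (induction I arbitrary: m rule: infinite_finite_induct)
  case (insert i I)
  then show ?case by (cases m) (auto simp: coeff_pCons)
qed (auto simp: coeff_1)

lemma coeff_prod_linear_mono:
  fixes y z :: "'a \<Rightarrow> real"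
  assumes "\<And>i. i \<in> I \<Longrightarrow> 0 \<le> y i \<and> y i \<le> z i"
  shows "coeff (\<Prod>i\<in>I. [:1, y i:]) m \<le> coeff (\<Prod>i\<in>I. [:1, z i:]) m"
  using assms
proof (induction I arbitrary: m rule: infinite_finite_induct)
  case (insert i I)
  have "y i * coeff (\<Prod>i\<in>I. [:1, y i:]) k \<le> z i * coeff (\<Prod>i\<in>I. [:1, z i:]) k" for k
    using insert by (intro mult_mono coeff_prod_linear_nonneg) (auto intro: order.trans)
  with insert show ?case by (cases m) (auto simp: coeff_pCons intro!: add_mono)
qed auto

text \<open>
  With \<open>e_m\<close> the elementary symmetric functions of all \<open>y i\<close> and \<open>g i\<close> those with \<open>y i\<close> left out,
  the derivative of the product gives \<open>(m + 1) e_{m+1} = \<Sum>i. y i * g i m\<close>, and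
  \<open>g i m = e_m - y i * g i (m - 1)\<close> for \<open>m > 0\<close>. The correction \<open>\<Sum>i. (y i)^2 * g i (m - 1)\<close> is at most
  \<open>R \<Sum>i. y i * g i (m - 1) = R m e_m\<close>.
\<close>
lemma coeff_prod_linear_recurrence:
  fixes y :: "'a \<Rightarrow> real"
  assumes I: "finite I" and y: "\<And>i. i \<in> I \<Longrightarrow> 0 \<le> y i \<and> y i \<le> R"
  defines "e \<equiv> coeff (\<Prod>i\<in>I. [:1, y i:])"
  shows "(sum y I - real m * R) * e m \<le> real (Suc m) * e (Suc m)"
proof -
  define g where "g i = coeff (\<Prod>j\<in>I - {i}. [:1, y j:])" for i
  have deriv: "real (Suc k) * e (Suc k) = (\<Sum>i\<in>I. y i * g i k)" for k
  proof -
    have "real (Suc k) * e (Suc k) = coeff (pderiv (\<Prod>i\<in>I. [:1, y i:])) k"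
      by (simp add: e_def coeff_pderiv)
    also have "\<dots> = (\<Sum>i\<in>I. y i * g i k)"
      by (simp add: pderiv_prod coeff_sum g_def pderiv_pCons mult.commute)
    finally show ?thesis .
  qed
  have g_nonneg: "0 \<le> g i k" for i k
    unfolding g_def using y by (intro coeff_prod_linear_nonneg) auto
  have split: "e k = g i k + (if k = 0 then 0 else y i * g i (k - 1))" if "i \<in> I" for i k
    using I that by (cases k) (auto simp: e_def g_def prod.remove[of I i] coeff_pCons)
  show ?thesis
  proof (cases m)
    case 0
    have "g i 0 = e 0" if "i \<in> I" for i using split[OF that, of 0] by simp
    then show ?thesis using deriv[of 0] 0 by (simp add: sum_distrib_right)
  next
    case (Suc k)
    have "e m = g i m + y i * g i k" if "i \<in> I" for i using split[OF that, of m] Suc by simp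
    then have "(\<Sum>i\<in>I. y i * e m) - (\<Sum>i\<in>I. y i * g i m) = (\<Sum>i\<in>I. y i * (y i * g i k))"
      unfolding sum_subtractf[symmetric]
      by (intro sum.cong refl) (simp add: algebra_simps)
    also have "\<dots> \<le> (\<Sum>i\<in>I. R * (y i * g i k))"
      using y g_nonneg by (intro sum_mono mult_right_mono) auto
    also have "\<dots> = real m * R * e m"
      using deriv[of k] Suc by (simp add: sum_distrib_left[symmetric])
    finally show ?thesis unfolding deriv sum_distrib_right[symmetric] by (simp add: algebra_simps)
  qed
qed

text \<open>
  Iterating the recurrence. With \<open>R\<close> and \<open>m\<close> fixed and \<open>S\<close> of the order of the number of variables,
  the left hand side is asymptotically \<open>S^m\<close>.
\<close>
lemma coeff_prod_linear_ge:
  fixes y :: "'a \<Rightarrow> real"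
  assumes I: "finite I" and y: "\<And>i. i \<in> I \<Longrightarrow> 0 \<le> y i \<and> y i \<le> R"
    and large: "real m * R \<le> S" "S \<le> sum y I" and R: "0 \<le> R"
  shows "(\<Prod>k<m. S - real k * R) \<le> fact m * coeff (\<Prod>i\<in>I. [:1, y i:]) m"
  using large(1)
proof (induction m)
  case 0
  then show ?case by (simp add: poly_0_coeff_0[symmetric] poly_prod)
next
  case (Suc m)
  let ?e = "coeff (\<Prod>i\<in>I. [:1, y i:])"
  have mR: "real m * R \<le> S" using Suc.prems R by (simp add: algebra_simps)
  have "(\<Prod>k<Suc m. S - real k * R) = (\<Prod>k<m. S - real k * R) * (S - real m * R)" by simp
  also have "\<dots> \<le> (fact m * ?e m) * (S - real m * R)"
    using Suc.IH[OF mR] mR by (intro mult_right_mono) auto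
  also have "\<dots> \<le> (fact m * ?e m) * (sum y I - real m * R)"
    using large(2) y by (intro mult_left_mono mult_nonneg_nonneg coeff_prod_linear_nonneg) auto
  also have "\<dots> = fact m * ((sum y I - real m * R) * ?e m)" by simp
  also have "\<dots> \<le> fact m * (real (Suc m) * ?e (Suc m))"
    using coeff_prod_linear_recurrence[OF I y] by (intro mult_left_mono) auto
  also have "\<dots> = fact (Suc m) * ?e (Suc m)" by (simp add: algebra_simps)
  finally show ?case .
qed

text \<open>
  Vieta's formula: reversing the polynomial turns the top coefficients into the low coefficients of
  \<open>\<Prod>z. 1 - z X\<close>.
\<close>
lemma coeff_prod_roots:
  fixes Z :: "'a :: {idom} set"
  assumes "finite Z" "m \<le> card Z"
  shows "coeff (\<Prod>z\<in>Z. [:- z, 1:]) (card Z - m) = (-1) ^ m * coeff (\<Prod>z\<in>Z. [:1, z:]) m"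
proof -
  let ?p = "\<Prod>z\<in>Z. [:- z, 1:]"
  have "degree ?p = card Z" by (simp add: degree_prod_sum_eq)
  then have "coeff ?p (card Z - m) = coeff (reflect_poly ?p) m"
    using assms(2) by (simp add: coeff_reflect_poly)
  also have "reflect_poly ?p = (\<Prod>z\<in>Z. [:1, - z:])"
    unfolding reflect_poly_prod by (intro prod.cong refl) (simp add: reflect_poly_def)
  also have "coeff \<dots> k = (-1) ^ k * coeff (\<Prod>z\<in>Z. [:1, z:]) k" for k
    using assms(1)
    by (induction Z arbitrary: k rule: finite_induct)
      (auto simp: coeff_1 coeff_pCons algebra_simps intro: gr0I split: nat.split)
  finally show ?thesis .
qed
lemma coeff_prod_linear_of_real:
  "coeff (\<Prod>i\<in>I. [:1, of_real (y i) :: complex:]) m = of_real (coeff (\<Prod>i\<in>I. [:1, y i:]) m)"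
  by (induction I arbitrary: m rule: infinite_finite_induct)
    (auto simp: coeff_1 coeff_pCons split: nat.split)

section \<open>The exterior map of the interval\<close>

text \<open>
  Every point of the interval is \<open>c + v + 1/v\<close> with \<open>\<bar>v\<bar> = 1\<close>, and \<open>v\<close>, \<open>1/v\<close> are its only
  representations.
\<close>
lemma joukowski_in_ext_dom:
  assumes "u \<noteq> 0" "cmod u < 1"
  shows "of_real c + u + 1 / u \<in> ext_dom c"
  unfolding ext_dom_def
proof
  assume "of_real c + u + 1 / u \<in> complex_of_real ` {c - 2..c + 2}"
  then obtain x where x: "x \<in> {c - 2..c + 2}" "of_real c + u + 1 / u = of_real x" by auto
  define v where "v = cis (arccos ((x - c) / 2))"
  have "1 / v = cnj v"
    unfolding v_def by (metis cis_cnj cis_inverse inverse_eq_divide)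
  moreover have "Re v = (x - c) / 2" using x(1) by (simp add: v_def cos_arccos)
  ultimately have "of_real c + v + 1 / v = of_real x"
    by (simp add: complex_eq_iff)
  moreover have nv: "cmod v = 1" by (simp add: v_def)
  ultimately have "u = v \<or> u * v = 1"
    using joukowski_eq_iff[of u v "of_real c"] x(2) assms(1) by force
  then show False using assms nv by (metis norm_mult norm_one mult.right_neutral less_irrefl)
qed

text \<open>
  With \<open>J v = c + v + 1/v\<close>, the function \<open>1 / \<Phi>(J v)\<close> maps the punctured unit disc into the unit disc
  and tends to 0 at 0, since \<open>\<Phi>\<close> fixes infinity. The singularity is removable and the Schwarz lemma
  applies. This bounds the Mahler measure from below in terms of the parameters of the zeros.
\<close>
lemma inverse_norm_le_norm_exterior_map:
  assumes \<Phi>: "exterior_map c \<Phi>" and u: "u \<noteq> 0" "cmod u < 1"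
  shows "1 / cmod u \<le> cmod (\<Phi> (of_real c + u + 1 / u))"
proof -
  define J where "J v = of_real c + v + 1 / v" for v :: complex
  define f where "f v = (if v = 0 then 0 else inverse (\<Phi> (J v)))" for v
  have J_ext: "J v \<in> ext_dom c" if "v \<noteq> 0" "cmod v < 1" for v
    using joukowski_in_ext_dom[OF that] by (simp add: J_def)
  have \<Phi>_gt: "cmod (\<Phi> (J v)) > 1" if "v \<noteq> 0" "cmod v < 1" for v
    using \<Phi> bij_betw_apply[OF _ J_ext[OF that], of \<Phi> "- cball 0 1"] by (simp add: exterior_map_def)
  have "\<Phi> \<circ> J holomorphic_on ball 0 1 - {0}"
  proof (rule holomorphic_on_compose_gen)
    show "J holomorphic_on ball 0 1 - {0}"
      unfolding J_def by (intro holomorphic_intros) auto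
    show "\<Phi> holomorphic_on ext_dom c" using \<Phi> by (simp add: exterior_map_def)
  qed (auto intro!: J_ext)
  then have "(\<lambda>v. inverse ((\<Phi> \<circ> J) v)) holomorphic_on ball 0 1 - {0}"
    using \<Phi>_gt by (intro holomorphic_intros) force+
  then have "f holomorphic_on ball 0 1 - {0}"
    by (rule holomorphic_transform) (auto simp: f_def)
  moreover have "(f \<longlongrightarrow> f 0) (at 0)"
  proof -
    have "filterlim J at_infinity (at 0)"
      unfolding J_def divide_inverse
      by (auto intro!: tendsto_add_filterlim_at_infinity tendsto_eq_intros
          filterlim_inverse_at_infinity)
    then have "filterlim (\<lambda>v. \<Phi> (J v)) at_infinity (at 0)"
      using \<Phi> filterlim_compose unfolding exterior_map_def by blast
    then have "((\<lambda>v. inverse (\<Phi> (J v))) \<longlongrightarrow> 0) (at 0)"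
      by (rule filterlim_compose[OF tendsto_inverse_0])
    moreover have "eventually (\<lambda>v. inverse (\<Phi> (J v)) = f v) (at 0)"
      by (auto simp: f_def eventually_at_filter)
    ultimately have "(f \<longlongrightarrow> 0) (at 0)" by (rule Lim_transform_eventually)
    then show ?thesis by (simp add: f_def)
  qed
  ultimately have "f holomorphic_on ball 0 1"
    by - (rule no_isolated_singularity'[of "{0}"], auto intro: tendsto_within_subset)
  moreover have "f 0 = 0" by (simp add: f_def)
  moreover have "cmod (f v) < 1" if "cmod v < 1" for v
    using \<Phi>_gt[of v] that by (simp add: f_def norm_inverse inverse_less_1_iff)
  ultimately have "cmod (f u) \<le> cmod u" by (rule Schwarz_Lemma(1)) (use u in auto)
  then have "inverse (cmod (\<Phi> (J u))) \<le> cmod u" using u by (simp add: f_def norm_inverse)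
  then have "inverse (cmod u) \<le> inverse (inverse (cmod (\<Phi> (J u))))"
    using \<Phi>_gt[OF u] by (intro le_imp_inverse_le) auto
  then show ?thesis by (simp add: J_def inverse_eq_divide)
qed

lemma ex_joukowski_preimage:
  fixes z :: complex
  shows "\<exists>u. u \<noteq> 0 \<and> cmod u \<le> 1 \<and> z = u + 1 / u"
proof -
  define w where "w = (z + csqrt (z\<^sup>2 - 4)) / 2"
  have "w * w - z * w + 1 = ((csqrt (z\<^sup>2 - 4))\<^sup>2 - (z\<^sup>2 - 4)) / 4"
    unfolding w_def
    by (simp add: power2_eq_square add_divide_distrib diff_divide_distrib algebra_simps)
  then have q: "w * w - z * w + 1 = 0" by simp
  then have w0: "w \<noteq> 0" by auto
  have z: "z = w + 1 / w" using q w0 by (simp add: field_simps)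
  show ?thesis
  proof (cases "cmod w \<le> 1")
    case False
    with z w0 show ?thesis by (intro exI[of _ "1 / w"]) (auto simp: norm_divide divide_le_eq)
  qed (use z w0 in blast)
qed

text \<open>
  Off the unit circle \<open>u\<close> is real. If \<open>u > 0\<close>, the point lies to the right of the interval and its
  truncation \<open>c + 2\<close> is large enough. If \<open>u < 0\<close>, it lies to the left, but being positive it has
  \<open>1/\<bar>u\<bar> < c\<close>; this turns \<open>1/\<bar>u\<bar> - \<bar>u\<bar>\<close>, the amount by which the point is smaller than \<open>c + 2 u\<close>,
  into a multiple of \<open>ln (1/\<bar>u\<bar>)\<close>.
\<close>
lemma min_joukowski_ge:
  assumes c: "c \<ge> 2" and a: "0 < a" and u: "u \<noteq> 0" "cmod u \<le> 1"
    and au: "of_real a = of_real c + u + 1 / u"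
  shows "min a (c + 2) \<ge> c + 2 * Re u + 2 * c * ln (cmod u)"
proof (cases "cmod u = 1")
  case True
  then have "1 / u = cnj u"
    using u by (simp add: divide_eq_eq complex_norm_square[symmetric] mult.commute)
  then have "a = c + 2 * Re u" using arg_cong[OF au, of Re] by simp
  moreover have "Re u \<le> 1" using complex_Re_le_cmod[of u] True by simp
  ultimately show ?thesis using True by simp
next
  case False
  define s where "s = Re u"
  have "Im (u + 1 / u) = 0" using arg_cong[OF au, of Im] by simp
  then have "Im u * (1 - 1 / (cmod u)\<^sup>2) = 0"
    by (simp add: Im_divide cmod_power2 algebra_simps)
  moreover have "(cmod u)\<^sup>2 \<noteq> 1" using False by (simp add: power2_eq_1_iff)
      (metis norm_ge_zero not_one_le_zero order.trans le_minus_one_simps(3))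
  ultimately have "Im u = 0" using u by (auto simp: divide_eq_eq)
  then have us: "u = of_real s" by (simp add: s_def complex_eq_iff)
  have a_eq: "a = c + s + 1 / s" using au unfolding us
    by (metis of_real_add of_real_divide of_real_1 of_real_eq_iff)
  have s: "s \<noteq> 0" "\<bar>s\<bar> < 1" using u False unfolding us by auto
  have ln_neg: "ln \<bar>s\<bar> < 0" using s by simp
  then have cln: "2 * c * ln \<bar>s\<bar> \<le> 0" using c by (simp add: mult_nonneg_nonpos)
  show ?thesis
  proof (cases "s > 0")
    case True
    have "s + 1 / s - 2 = (1 - s)\<^sup>2 / s" using True by (simp add: field_simps power2_eq_square)
    then have "s + 1 / s \<ge> 2" using True by (smt (verit) divide_nonneg_pos zero_le_power2)
    then show ?thesis using True s cln a_eq us by simp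
  next
    case neg: False
    define y where "y = - s"
    have y: "0 < y" "y < 1" using neg s by (auto simp: y_def)
    have "1 / y < c" using a a_eq y by (simp add: y_def)
    then have "1 / y - y \<le> c * (1 - y\<^sup>2)"
    proof -
      have "1 / y - y = 1 / y * (1 - y\<^sup>2)" using y by (simp add: field_simps power2_eq_square)
      also have "\<dots> \<le> c * (1 - y\<^sup>2)"
        using \<open>1 / y < c\<close> y by (intro mult_right_mono) (auto simp: power_le_one)
      finally show ?thesis .
    qed
    moreover have "2 * ln y \<le> y\<^sup>2 - 1"
      using ln_le_minus_one[of "y\<^sup>2"] y by (simp add: ln_realpow)
    then have "c * (2 * ln y) \<le> c * (y\<^sup>2 - 1)" using c by (intro mult_left_mono) auto
    moreover have "1 / y \<ge> 1" using y by simp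
    moreover have "a = c - y - 1 / y" using a_eq by (simp add: y_def)
    ultimately show ?thesis using y c us cln by (simp add: y_def algebra_simps)
  qed
qed

section \<open>Polynomials with simple positive zeros\<close>

context
  fixes p :: "int poly" and n :: nat and Z :: "complex set"
  assumes p: "p \<in> Z_simple n pos_reals"
  defines "Z \<equiv> {z. poly (map_poly of_int p) z = 0}"
begin

lemma finite_zeros: "finite Z"
  using p unfolding Z_def Z_simple_def by (intro poly_roots_finite) (auto simp: map_poly_eq_0_iff)

lemma of_real_Re_zeros: "z \<in> Z \<Longrightarrow> of_real (Re z) = z" and Re_zeros_pos: "z \<in> Z \<Longrightarrow> Re z > 0"
  using p unfolding Z_def Z_simple_def pos_reals_def by force+

lemma order_zeros: "order z (map_poly of_int p) = (if z \<in> Z then 1 else 0)"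
  using p order_root[of "map_poly of_int p :: complex poly" z]
  unfolding Z_def Z_simple_def by auto

lemma factorization_over_zeros:
  "map_poly of_int p = Polynomial.smult (of_int (lead_coeff p)) (\<Prod>z\<in>Z. [:- z, 1:])"
proof -
  have "rsquarefree (map_poly of_int p :: complex poly)"
    using p order_zeros unfolding rsquarefree_def by (auto simp: Z_simple_def map_poly_eq_0_iff)
  then show ?thesis
    using complex_poly_decompose_rsquarefree[of "map_poly of_int p"]
    by (simp add: Z_def coeff_map_poly degree_map_poly)
qed

lemma card_zeros: "card Z = n"
proof -
  have "degree (map_poly of_int p :: complex poly) = n"
    using p by (simp add: Z_simple_def degree_map_poly)
  then show ?thesis
    using p unfolding factorization_over_zeros by (simp add: degree_prod_sum_eq Z_simple_def)
qed

lemma lead_coeff_nonzero: "lead_coeff p \<noteq> 0"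
proof -
  have "p \<noteq> 0" using p by (simp add: Z_simple_def)
  then show ?thesis by simp
qed

lemma abs_lead_coeff_ge_1: "\<bar>real_of_int (lead_coeff p)\<bar> \<ge> 1"
  using lead_coeff_nonzero by linarith

lemma gen_mahler_Z_simple:
  "gen_mahler c \<Phi> (map_poly of_int p)
    = \<bar>real_of_int (lead_coeff p)\<bar> * (\<Prod>z\<in>Z \<inter> ext_dom c. cmod (\<Phi> z))"
proof -
  have p0: "map_poly of_int p \<noteq> (0 :: complex poly)"
    using p by (simp add: Z_simple_def map_poly_eq_0_iff)
  have "proots (map_poly of_int p) = mset_set Z"
    using p0 finite_zeros by (intro multiset_eqI) (simp add: order_zeros count_mset_set')
  then show ?thesis
    by (simp add: gen_mahler_def prod_unfold_prod_mset[symmetric] coeff_map_poly degree_map_poly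
        finite_zeros Int_def)
qed

text \<open>
  The resultant of \<open>p\<close> and its derivative is an integer, and nonzero since the zeros are simple. With
  \<open>a\<close> the leading coefficient, \<open>p' z = a \<Prod>(z - w)\<close> at a zero \<open>z\<close>, and \<open>p'\<close> has degree \<open>n - 1\<close>, so \<open>a\<close>
  occurs \<open>(n - 1) + n\<close> times.
\<close>
lemma ln_discriminant_nonneg:
  assumes n: "n \<ge> 1"
  shows "0 \<le> (2 * real n - 1) * ln \<bar>real_of_int (lead_coeff p)\<bar>
    + (\<Sum>z\<in>Z. \<Sum>w\<in>Z - {z}. ln (cmod (z - w)))"
proof -
  define a where "a = complex_of_int (lead_coeff p)"
  have a0: "a \<noteq> 0" using lead_coeff_nonzero by (simp add: a_def)
  have deriv: "poly (map_poly of_int (pderiv p)) z = a * (\<Prod>w\<in>Z - {z}. z - w)" if "z \<in> Z" for z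
  proof -
    have "map_poly of_int (pderiv p) = (pderiv (map_poly of_int p) :: complex poly)"
      by (intro poly_eqI) (simp add: coeff_map_poly coeff_pderiv)
    also have "poly \<dots> z = a * (\<Sum>v\<in>Z. \<Prod>w\<in>Z - {v}. z - w)"
      unfolding factorization_over_zeros a_def
      by (simp add: pderiv_smult pderiv_prod poly_sum poly_prod pderiv_pCons)
    also have "(\<Sum>v\<in>Z. \<Prod>w\<in>Z - {v}. z - w) = (\<Sum>v\<in>{z}. \<Prod>w\<in>Z - {v}. z - w)"
      using that finite_zeros by (intro sum.mono_neutral_right) auto
    finally show ?thesis by simp
  qed
  define N where "N = a ^ (n - 1) * (\<Prod>z\<in>Z. poly (map_poly of_int (pderiv p)) z)"
  have "N \<in> \<int>"
    using lead_coeff_power_times_prod_over_roots_Ints[of p "pderiv p" "n - 1"] p card_zeros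
    by (simp add: N_def a_def Z_simple_def degree_pderiv flip: Z_def)
  then obtain k where k: "N = of_int k" by (elim Ints_cases)
  have N_eq: "N = a ^ (n - 1) * (\<Prod>z\<in>Z. a * (\<Prod>w\<in>Z - {z}. z - w))"
    unfolding N_def by (simp add: deriv cong: prod.cong)
  have "N \<noteq> 0" unfolding N_eq using a0 finite_zeros by auto
  then have "k \<noteq> 0" using k by auto
  then have "1 \<le> cmod N" unfolding k norm_of_int by linarith
  then have "0 \<le> ln (cmod N)" by simp
  also have "cmod N = cmod a ^ (n - 1) * (\<Prod>z\<in>Z. cmod a * (\<Prod>w\<in>Z - {z}. cmod (z - w)))"
    unfolding N_eq by (simp add: norm_mult norm_power prod_norm[symmetric])
  also have "ln \<dots> = (real n - 1) * ln (cmod a)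
      + (\<Sum>z\<in>Z. ln (cmod a) + (\<Sum>w\<in>Z - {z}. ln (cmod (z - w))))"
  proof -
    have "ln (cmod a * (\<Prod>w\<in>Z - {z}. cmod (z - w))) = ln (cmod a) + (\<Sum>w\<in>Z - {z}. ln (cmod (z - w)))" for z
    proof -
      have "ln (\<Prod>w\<in>Z - {z}. cmod (z - w)) = (\<Sum>w\<in>Z - {z}. ln (cmod (z - w)))"
        using finite_zeros by (intro ln_prod) auto
      then show ?thesis using a0 finite_zeros by (subst ln_mult) auto
    qed
    moreover have pos: "cmod a * (\<Prod>w\<in>Z - {z}. cmod (z - w)) > 0" for z
      using a0 by (intro mult_pos_pos prod_pos) auto
    then have "(\<Prod>z\<in>Z. cmod a * (\<Prod>w\<in>Z - {z}. cmod (z - w))) > 0"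
      by (intro prod_pos)
    moreover have "ln (\<Prod>z\<in>Z. cmod a * (\<Prod>w\<in>Z - {z}. cmod (z - w)))
        = (\<Sum>z\<in>Z. ln (cmod a * (\<Prod>w\<in>Z - {z}. cmod (z - w))))"
      using finite_zeros pos by (intro ln_prod) (auto simp: less_imp_neq[symmetric])
    ultimately show ?thesis using a0 n by (simp add: ln_mult ln_realpow of_nat_diff)
  qed
  also have "\<dots> = (2 * real n - 1) * ln (cmod a) + (\<Sum>z\<in>Z. \<Sum>w\<in>Z - {z}. ln (cmod (z - w)))"
    by (simp add: sum.distrib card_zeros algebra_simps)
  finally show ?thesis by (simp add: a_def)
qed

text \<open>
  Passes from a lower bound \<open>\<sigma>\<close> for the mean of the truncated zeros to the coefficients, using
  \<open>n choose m \<le> n^m / m!\<close>.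
\<close>
lemma abs_coeff_ge:
  assumes c: "c \<ge> 2" and m: "m \<le> n" and n: "n \<ge> 1"
    and \<sigma>: "real n * \<sigma> \<le> (\<Sum>z\<in>Z. min (Re z) (c + 2))" "real m * (c + 2) \<le> real n * \<sigma>"
  shows "(\<Prod>k<m. \<sigma> - real k * (c + 2) / real n) \<le> real_of_int \<bar>coeff p (n - m)\<bar> / real (n choose m)"
proof -
  let ?e = "\<lambda>y. coeff (\<Prod>z\<in>Z. [:1, y z:]) m :: real"
  let ?y = "\<lambda>z. min (Re z) (c + 2)"
  have y: "0 \<le> ?y z \<and> ?y z \<le> c + 2" "?y z \<le> Re z" if "z \<in> Z" for z
    using Re_zeros_pos[OF that] c by auto
  have choose: "real (n choose m) * fact m \<le> real n ^ m" "0 < real (n choose m)"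
    using of_nat_mono[OF binomial_fact_pow[of n m], where 'a = real] m by simp_all
  have "of_int (coeff p (n - m)) = of_int (lead_coeff p) * ((-1) ^ m * coeff (\<Prod>z\<in>Z. [:1, z:]) m :: complex)"
    using coeff_prod_roots[OF finite_zeros, of m] m card_zeros
      arg_cong[OF factorization_over_zeros, of "\<lambda>q. coeff q (n - m)"]
    by (simp add: coeff_map_poly)
  also have "coeff (\<Prod>z\<in>Z. [:1, z:]) m = of_real (?e Re)"
    by (subst coeff_prod_linear_of_real[symmetric]) (simp add: of_real_Re_zeros cong: prod.cong)
  finally have "cmod (of_int (coeff p (n - m))) = \<bar>real_of_int (lead_coeff p)\<bar> * \<bar>?e Re\<bar>"
    by (simp add: norm_mult norm_power)
  then have "\<bar>real_of_int (coeff p (n - m))\<bar> = \<bar>real_of_int (lead_coeff p)\<bar> * \<bar>?e Re\<bar>" by simp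
  also have "\<dots> \<ge> 1 * \<bar>?e Re\<bar>" using abs_lead_coeff_ge_1 by (intro mult_right_mono) auto
  finally have "?e Re \<le> \<bar>real_of_int (coeff p (n - m))\<bar>" by linarith
  moreover have "?e ?y \<le> ?e Re" using y by (intro coeff_prod_linear_mono) auto
  moreover have "(\<Prod>k<m. real n * \<sigma> - real k * (c + 2)) \<le> fact m * ?e ?y"
    using y c by (intro coeff_prod_linear_ge[OF finite_zeros _ \<sigma>(2,1)]) auto
  ultimately have "(\<Prod>k<m. real n * \<sigma> - real k * (c + 2)) \<le> fact m * \<bar>real_of_int (coeff p (n - m))\<bar>"
    by (smt (verit) mult_left_mono fact_ge_zero)
  also have "(\<Prod>k<m. real n * \<sigma> - real k * (c + 2))
      = (\<Prod>k<m. real n * (\<sigma> - real k * (c + 2) / real n))"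
    using n by (intro prod.cong) (auto simp: field_simps)
  also have "\<dots> = real n ^ m * (\<Prod>k<m. \<sigma> - real k * (c + 2) / real n)"
    by (simp add: prod.distrib)
  finally have *: "real n ^ m * (\<Prod>k<m. \<sigma> - real k * (c + 2) / real n)
      \<le> fact m * \<bar>real_of_int (coeff p (n - m))\<bar>" .
  have "0 \<le> (\<Prod>k<m. \<sigma> - real k * (c + 2) / real n)"
  proof (intro prod_nonneg ballI)
    fix k assume "k \<in> {..<m}"
    then have "real k * (c + 2) \<le> real m * (c + 2)" using c by (intro mult_right_mono) auto
    then show "0 \<le> \<sigma> - real k * (c + 2) / real n" using \<sigma>(2) n by (simp add: field_simps)
  qed
  then have "(real (n choose m) * fact m) * (\<Prod>k<m. \<sigma> - real k * (c + 2) / real n)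
      \<le> real n ^ m * (\<Prod>k<m. \<sigma> - real k * (c + 2) / real n)"
    using choose(1) by (intro mult_right_mono)
  then have "fact m * (real (n choose m) * (\<Prod>k<m. \<sigma> - real k * (c + 2) / real n))
      \<le> real n ^ m * (\<Prod>k<m. \<sigma> - real k * (c + 2) / real n)"
    by (simp only: mult_ac)
  also note *
  finally have "real (n choose m) * (\<Prod>k<m. \<sigma> - real k * (c + 2) / real n)
      \<le> \<bar>real_of_int (coeff p (n - m))\<bar>"
    by (simp only: mult_le_cancel_left_pos fact_gt_zero)
  then show ?thesis using choose(2) by (simp add: pos_le_divide_eq mult.commute)
qed

lemma gen_mahler_Z_simple_ge_1:
  assumes "exterior_map c \<Phi>"
  shows "gen_mahler c \<Phi> (map_poly of_int p) \<ge> 1"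
proof -
  have "1 \<le> (\<Prod>z\<in>Z \<inter> ext_dom c. cmod (\<Phi> z))"
    using bij_betw_apply[of \<Phi> "ext_dom c" "- cball 0 1"] assms
    by (intro prod_ge_1) (force simp: exterior_map_def)
  then show ?thesis
    unfolding gen_mahler_Z_simple using abs_lead_coeff_ge_1 mult_mono[of 1 _ 1] by fastforce
qed

text \<open>
  The quantitative core: \<open>\<epsilon>\<close> bounds the mean of \<open>ln (1/\<bar>u\<bar>)\<close>, and the square root, which comes from
  comparing the discriminant with the energy bound at \<open>r = 1 - 1/n\<close>, bounds the mean of \<open>Re u\<close>.
\<close>
lemma sum_truncated_zeros_ge:
  assumes c: "c \<ge> 2" and \<Phi>: "exterior_map c \<Phi>" and n: "n \<ge> 2"
  defines "\<epsilon> \<equiv> ln (gen_mahler c \<Phi> (map_poly of_int p)) / real n"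
  shows "real n * (c - 2 * sqrt (2 * (\<epsilon> + ln (real n) / real n + ln (2 / (2 - 1 / real n)))) - 2 * c * \<epsilon>)
    \<le> (\<Sum>z\<in>Z. min (Re z) (c + 2))"
proof -
  obtain u where u: "u z \<noteq> 0" "cmod (u z) \<le> 1" "z - of_real c = u z + 1 / u z" for z
    using ex_joukowski_preimage[of "_ - of_real c"] by metis
  have zu: "z = of_real c + u z + 1 / u z" for z
    using u(3)[of z] by (metis add.assoc diff_add_cancel add.commute)
  define a where "a = \<bar>real_of_int (lead_coeff p)\<bar>"
  define H where "H = (\<Sum>z\<in>Z. - ln (cmod (u z)))"
  define C where "C = (\<Sum>z\<in>Z. Re (u z))"
  \<comment> \<open>With this \<open>r\<close> both the cost of the diagonal, \<open>ln (1 / (1 - r)) / n\<close>, and the cost of the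
    damping, \<open>ln (2 / (1 + r))\<close>, tend to 0.\<close>
  define r where "r = 1 - 1 / real n"
  define B where "B = \<epsilon> + ln (real n) / real n + ln (2 / (2 - 1 / real n))"
  have r: "1 / 2 \<le> r" "0 < r" "r < 1" using n by (auto simp: r_def field_simps)
  have a: "a \<ge> 1" using abs_lead_coeff_ge_1 by (simp add: a_def)
  have lnM: "ln a + H \<le> real n * \<epsilon>"
  proof -
    \<comment> \<open>The zeros in the interval contribute neither to \<open>H\<close> nor to the Mahler measure.\<close>
    have "cmod (u z) = 1" if "z \<in> Z - ext_dom c" for z
    proof (rule ccontr)
      assume "cmod (u z) \<noteq> 1"
      then have "z \<in> ext_dom c"
        using joukowski_in_ext_dom[of "u z" c] u[of z] zu[of z] by (simp flip: zu)
      with that show False by simp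
    qed
    then have "H = (\<Sum>z\<in>Z \<inter> ext_dom c. - ln (cmod (u z)))"
      unfolding H_def using finite_zeros by (intro sum.mono_neutral_right) auto
    also have "\<dots> \<le> (\<Sum>z\<in>Z \<inter> ext_dom c. ln (cmod (\<Phi> z)))"
    proof (rule sum_mono)
      fix z assume "z \<in> Z \<inter> ext_dom c"
      then have \<Phi>z: "cmod (\<Phi> z) > 1"
        using bij_betw_apply[of \<Phi> "ext_dom c" "- cball 0 1" z] \<Phi> by (auto simp: exterior_map_def)
      have "1 / cmod (u z) \<le> cmod (\<Phi> z)"
      proof (cases "cmod (u z) = 1")
        case False
        then show ?thesis
          using inverse_norm_le_norm_exterior_map[OF \<Phi>, of "u z"] u[of z] by (simp flip: zu)
      qed (use \<Phi>z in auto)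
      then have "ln (1 / cmod (u z)) \<le> ln (cmod (\<Phi> z))" using u(1)[of z] by (intro ln_mono) auto
      then show "- ln (cmod (u z)) \<le> ln (cmod (\<Phi> z))" using u(1)[of z] by (simp add: ln_div)
    qed
    finally have "ln a + H \<le> ln a + (\<Sum>z\<in>Z \<inter> ext_dom c. ln (cmod (\<Phi> z)))" by simp
    also have "\<dots> = ln (a * (\<Prod>z\<in>Z \<inter> ext_dom c. cmod (\<Phi> z)))"
    proof -
      have "cmod (\<Phi> z) > 0" if "z \<in> Z \<inter> ext_dom c" for z
        using that bij_betw_apply[of \<Phi> "ext_dom c" "- cball 0 1" z] \<Phi> by (auto simp: exterior_map_def)
      then have "(\<Prod>z\<in>Z \<inter> ext_dom c. cmod (\<Phi> z)) > 0"
        "ln (\<Prod>z\<in>Z \<inter> ext_dom c. cmod (\<Phi> z)) = (\<Sum>z\<in>Z \<inter> ext_dom c. ln (cmod (\<Phi> z)))"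
        using finite_zeros by (auto intro!: prod_pos ln_prod)
      then show ?thesis using a by (simp add: ln_mult)
    qed
    finally show ?thesis using n by (simp add: \<epsilon>_def gen_mahler_Z_simple a_def)
  qed
  have H0: "0 \<le> H" unfolding H_def using u by (intro sum_nonneg) simp
  have H_le: "H \<le> real n * \<epsilon>" using lnM a ln_ge_zero[of a] by linarith
  have "C\<^sup>2 \<le> (real n)\<^sup>2 * (2 * B)"
  proof -
    have diff: "(u z + 1 / u z) - (u w + 1 / u w) = z - w" for z w
      unfolding u(3)[symmetric] by simp
    have inj: "inj_on (\<lambda>z. u z + 1 / u z) Z"
      unfolding u(3)[symmetric] by (intro inj_onI) simp
    have "0 \<le> (2 * real n - 1) * ln a + (\<Sum>z\<in>Z. \<Sum>w\<in>Z - {z}. ln (cmod (z - w)))"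
      using ln_discriminant_nonneg n by (simp add: a_def)
    also have "(\<Sum>z\<in>Z. \<Sum>w\<in>Z - {z}. ln (cmod (z - w))) \<le> 2 * (real n - 1) * H - 2 * r * C\<^sup>2
        + 2 * real n * ln (1 / (1 - r)) + 2 * real n * (real n - 1) * ln (2 / (1 + r))"
      using sum_ln_joukowski_diff_le[OF finite_zeros _ inj r(2,3)] u(1,2) unfolding diff
      by (simp add: card_zeros H_def C_def)
    also have "(2 * real n - 1) * ln a \<le> 2 * real n * ln a"
      using a by (intro mult_right_mono) auto
    also have "2 * (real n - 1) * H \<le> 2 * real n * H"
      using H0 by (intro mult_right_mono) auto
    also have "ln (1 / (1 - r)) = ln (real n)" by (simp add: r_def)
    also have "2 * real n * (real n - 1) * ln (2 / (1 + r)) \<le> 2 * real n * real n * ln (2 / (1 + r))"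
      using r by (intro mult_right_mono mult_left_mono) (auto simp: le_divide_eq)
    also have "1 + r = 2 - 1 / real n" by (simp add: r_def)
    finally have "2 * r * C\<^sup>2 \<le> 2 * real n * (ln a + H) + 2 * real n * ln (real n)
        + 2 * real n * real n * ln (2 / (2 - 1 / real n))"
      by (simp add: algebra_simps)
    also have "2 * real n * (ln a + H) \<le> 2 * real n * (real n * \<epsilon>)"
      using lnM by (intro mult_left_mono) auto
    finally have "2 * r * C\<^sup>2 \<le> (real n)\<^sup>2 * (2 * B)"
      using n by (simp add: B_def power2_eq_square algebra_simps)
    moreover have "1 * C\<^sup>2 \<le> 2 * r * C\<^sup>2" using r by (intro mult_right_mono) auto
    ultimately show ?thesis by simp
  qed
  then have "\<bar>C\<bar> \<le> sqrt ((real n)\<^sup>2 * (2 * B))" by (simp add: real_le_rsqrt)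
  then have C_le: "\<bar>C\<bar> \<le> real n * sqrt (2 * B)" by (simp add: real_sqrt_mult)
  have "real n * (c - 2 * sqrt (2 * B) - 2 * c * \<epsilon>) \<le> real n * c + 2 * C - 2 * c * H"
  proof -
    have "2 * c * H \<le> 2 * c * (real n * \<epsilon>)" using H_le c by (intro mult_left_mono) auto
    then show ?thesis using C_le by (simp add: algebra_simps abs_le_iff)
  qed
  also have "\<dots> = (\<Sum>z\<in>Z. c + 2 * Re (u z) + 2 * c * ln (cmod (u z)))"
    by (simp add: C_def H_def sum.distrib card_zeros sum_distrib_left sum_negf)
  also have "\<dots> \<le> (\<Sum>z\<in>Z. min (Re z) (c + 2))"
    using c u(1,2) of_real_Re_zeros Re_zeros_pos zu by (intro sum_mono min_joukowski_ge) auto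
  finally show ?thesis by (simp add: B_def)
qed
end

section \<open>The limit of the coefficients\<close>

theorem theorem2p9:
  fixes P :: "nat \<Rightarrow> int poly" and c :: real and \<Phi> :: "complex \<Rightarrow> complex" and m :: nat
  assumes "c \<ge> 2"
    and "exterior_map c \<Phi>"
    and "\<And>n. n \<ge> 1 \<Longrightarrow> P n \<in> Z_simple n pos_reals"
    and "(\<lambda>n. gen_mahler c \<Phi> (map_poly of_int (P n)) powr (1 / real n)) \<longlonglongrightarrow> 1"
    and "m \<ge> 1"
  shows "liminf (\<lambda>n. ereal (real_of_int \<bar>coeff (P n) (n - m)\<bar> / real (n choose m))) \<ge> ereal (c ^ m)
         \<and> c ^ m \<ge> 2 ^ m"
proof
  show "c ^ m \<ge> 2 ^ m" using assms(1) by (intro power_mono) auto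
  define M where "M n = gen_mahler c \<Phi> (map_poly of_int (P n))" for n
  define \<epsilon> where "\<epsilon> n = ln (M n) / real n" for n
  define \<sigma> where "\<sigma> n = c
    - 2 * sqrt (2 * (\<epsilon> n + ln (real n) / real n + ln (2 / (2 - 1 / real n)))) - 2 * c * \<epsilon> n" for n
  have "(\<lambda>n. ln (M n powr (1 / real n))) \<longlonglongrightarrow> ln 1"
    using assms(4) unfolding M_def by (intro tendsto_ln) auto
  moreover have "eventually (\<lambda>n. ln (M n powr (1 / real n)) = \<epsilon> n) sequentially"
    using eventually_ge_at_top[of 1]
  proof eventually_elim
    case (elim n)
    have "M n \<ge> 1"
      unfolding M_def using gen_mahler_Z_simple_ge_1[OF assms(3)[OF elim] assms(2)] .
    then show ?case by (simp add: \<epsilon>_def ln_powr)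
  qed
  ultimately have \<epsilon>_lim: "\<epsilon> \<longlonglongrightarrow> 0" by (simp add: tendsto_cong)
  have "(\<lambda>n. ln (real n) / real n) \<longlonglongrightarrow> 0" "(\<lambda>n. ln (2 / (2 - 1 / real n))) \<longlonglongrightarrow> 0"
    by real_asymp+
  then have "\<sigma> \<longlonglongrightarrow> c - 2 * sqrt (2 * (0 + 0 + 0)) - 2 * c * 0"
    unfolding \<sigma>_def using \<epsilon>_lim by (intro tendsto_diff tendsto_mult tendsto_real_sqrt tendsto_add tendsto_const)
  then have \<sigma>_lim: "\<sigma> \<longlonglongrightarrow> c" by simp
  have factor_lim: "(\<lambda>n. \<sigma> n - real k * (c + 2) / real n) \<longlonglongrightarrow> c" for k
    using tendsto_diff[OF \<sigma>_lim lim_const_over_n[of "real k * (c + 2)"]] by simp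
  have "(\<lambda>n. \<Prod>k<m. \<sigma> n - real k * (c + 2) / real n) \<longlonglongrightarrow> (\<Prod>k<m. c)"
    by (intro tendsto_prod factor_lim)
  then have "(\<lambda>n. ereal (\<Prod>k<m. \<sigma> n - real k * (c + 2) / real n)) \<longlonglongrightarrow> ereal (c ^ m)"
    by simp
  then have "ereal (c ^ m) = liminf (\<lambda>n. ereal (\<Prod>k<m. \<sigma> n - real k * (c + 2) / real n))"
    by (intro lim_imp_Liminf[symmetric]) simp_all
  also have "\<dots> \<le> liminf (\<lambda>n. ereal (real_of_int \<bar>coeff (P n) (n - m)\<bar> / real (n choose m)))"
  proof (rule Liminf_mono)
    have "eventually (\<lambda>n. \<sigma> n - real m * (c + 2) / real n > 0) sequentially"
      using factor_lim[of m] assms(1) by (intro order_tendstoD) auto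
    then show "eventually (\<lambda>n. ereal (\<Prod>k<m. \<sigma> n - real k * (c + 2) / real n)
        \<le> ereal (real_of_int \<bar>coeff (P n) (n - m)\<bar> / real (n choose m))) sequentially"
      using eventually_ge_at_top[of "max m 2"]
    proof eventually_elim
      case (elim n)
      have n: "n \<ge> 2" "n \<ge> 1" "m \<le> n" using elim(2) by auto
      have "real m * (c + 2) \<le> real n * \<sigma> n" using elim(1) n by (simp add: field_simps)
      then show ?case
        using abs_coeff_ge[OF assms(3)[OF n(2)] assms(1) n(3,2)]
          sum_truncated_zeros_ge[OF assms(3)[OF n(2)] assms(1,2) n(1)]
        by (simp add: \<sigma>_def \<epsilon>_def M_def)
    qed
  qed
  finally show "liminf (\<lambda>n. ereal (real_of_int \<bar>coeff (P n) (n - m)\<bar> / real (n choose m)))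
      \<ge> ereal (c ^ m)" .
qed

end
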